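(* Let $0\le r<s$ be arbitrary. Define $\hat\phi^s_r:\mathbb{R}\times\hat\Omega^s_r\to\Lambda^s_r$ and $\check\phi^s_r:\mathbb{R}\times\check\Omega^s_r\to\Lambda^s_r$ by $$\hat\phi^s_r(a,\hat\omega)=\varphi^s_{r,a}(\hat\omega),\quad (a,\hat\omega)\in\mathbb{R}\times\hat\Omega^s_r,\qquad \check\phi^s_r(b,\check\omega)=\varphi^{s,b}_r(\check\omega),\quad (b,\check\omega)\in\mathbb{R}\times\check\Omega^s_r.$$ Then $\hat\phi^s_r$ and $\check\phi^s_r$ are continuous. In particular, for arbitrary $a,b\in\mathbb{R}$, the functions $\varphi^s_{r,a}:\hat\Omega^s_r\to\Lambda^s_{r,a}$ and $\varphi^{s,b}_r:\check\Omega^s_r\to\Lambda^{s,b}_r$ are continuous.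
   Context: Fix a constant $c>0$. For $0\le r<s$ and $a,b\in\mathbb{R}$ let $F_{r,a}=\{(t,x)\in\mathbb{R}^2: r\le t,\ a-c(t-r)\le x\le a+c(t-r)\}$, $B_{s,b}=\{(t,x)\in\mathbb{R}^2: t\le s,\ b-c(s-t)\le x\le b+c(s-t)\}$, and $P^{s,b}_{r,a}=F_{r,a}\cap B_{s,b}$ (nonempty if and only if $|b-a|\le c(s-r)$). When $P^{s,b}_{r,a}\ne\emptyset$ let $I^{s,b}_{r,a}=\{x\in\mathbb{R}:(\tfrac12(r+s),x)\in P^{s,b}_{r,a}\}$, a (possibly degenerate) closed interval. Also let $I^s_{r,a}=[a-c(s-r),a+c(s-r)]$. Standing assumptions: (i) for all such $r,s,a,b$ with $P^{s,b}_{r,a}\neq\emptyset$ we are given a continuous function $\lambda^{s,b}_{r,a}:[0,1]\to I^{s,b}_{r,a}$ mapping $[0,1]$ onto $I^{s,b}_{r,a}$, such that $(a,b,r,s,\xi)\mapsto\lambda^{s,b}_{r,a}(\xi)$ is continuous on $\{(a,b,r,s,\xi)\in\mathbb{R}^5: 0\le r<s,\ |b-a|\le c(s-r),\ \xi\in[0,1]\}$; (ii) for all $0\le r<s$ and $a\in\mathbb{R}$ we are given a continuous function $\lambda^s_{r,a}:[0,1]\to I^s_{r,a}$ onto $I^s_{r,a}$, such that $(a,r,s,\xi)\mapsto\lambda^s_{r,a}(\xi)$ is continuous on $\{(a,r,s,\xi):a\in\mathbb{R},\ 0\le r<s,\ \xi\in[0,1]\}$. Let $t_{nj}=r+\frac{j}{2^n}(s-r)$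 for $0\le j\le 2^n$, $n\ge 0$; $V^s_{r,n}=\{t_{nj}:0<j<2^n\}$ for $n\ge1$; $V^s_r=\bigcup_{n\ge1}V^s_{r,n}$; $\Omega^s_r=[0,1]^{V^s_r}$; $\hat V^s_r=V^s_r\cup\{s\}$, $\check V^s_r=V^s_r\cup\{r\}$, $\hat\Omega^s_r=[0,1]^{\hat V^s_r}$, $\check\Omega^s_r=[0,1]^{\check V^s_r}$, all with product topologies. The maps $\hat\pi:\hat\Omega^s_r\to\Omega^s_r$ and $\check\pi:\check\Omega^s_r\to\Omega^s_r$ are restriction of coordinates to $V^s_r$. Let $C^s_r$ be the space of continuous $x:[r,s]\to\mathbb{R}$ with the uniform (sup-norm) topology; $\Lambda^s_r=\{x\in C^s_r:|x(v)-x(u)|\le c|v-u|\text{ for all }u,v\in[r,s]\}$; $\Lambda^{s,b}_{r,a}=\{x\in\Lambda^s_r: x(r)=a,\ x(s)=b\}$, $\Lambda^s_{r,a}=\{x\in\Lambda^s_r:x(r)=a\}$, $\Lambda^{s,b}_r=\{x\in\Lambda^s_r:x(s)=b\}$, all with subspace topologies. Definition of $\varphi^{s,b}_{r,a}:\Omega^s_r\to\Lambda^{s,b}_{r,a}$ (when $P^{s,b}_{r,a}\neq\emptyset$): for $\omega\in\Omega^s_r$, the function $\varphi(\omega)=\varphi^{s,b}_{r,a}(\omega)$ is defined on $V^s_r\cup\{r,s\}$ recursively by $\varphi(\omega)(r)=a$, $\varphi(\omega)(s)=b$, and, for $m\ge1$ and $1\le j\le 2^{m-1}$, writing $a_{m-1,i}=\varphi(\omega)(t_{m-1,i})$,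 $$\varphi(\omega)(t_{m,2j-1})=\lambda^{t_{m-1,j},a_{m-1,j}}_{t_{m-1,j-1},a_{m-1,j-1}}(\omega_{t_{m,2j-1}})$$ (at each step the relevant set $P^{t_{m-1,j},a_{m-1,j}}_{t_{m-1,j-1},a_{m-1,j-1}}$ is nonempty, and $t_{m,2j}=t_{m-1,j}$). The resulting function is $c$-Lipschitz on the dense set $V^s_r\cup\{r,s\}$ and $\varphi^{s,b}_{r,a}(\omega)\in\Lambda^{s,b}_{r,a}$ denotes its unique continuous extension to $[r,s]$. Definition of $\varphi^s_{r,a}$ and $\varphi^{s,b}_r$: for $\hat\omega\in\hat\Omega^s_r$, $\varphi^s_{r,a}(\hat\omega)=\varphi^{s,b'}_{r,a}(\hat\pi(\hat\omega))$ with $b'=\lambda^s_{r,a}(\hat\omega_s)$; for $\check\omega\in\check\Omega^s_r$, $\varphi^{s,b}_r(\check\omega)=\varphi^{s,b}_{r,a'}(\check\pi(\check\omega))$ with $a'=\lambda^s_{r,b}(\check\omega_r)$. *)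

theory Defs
  imports "HOL-Analysis.Analysis"
begin

definition fwd_cone :: "real \<Rightarrow> real \<Rightarrow> real \<Rightarrow> (real \<times> real) set" where
  "fwd_cone c r a = {(t, x). r \<le> t \<and> a - c * (t - r) \<le> x \<and> x \<le> a + c * (t - r)}"

definition bwd_cone :: "real \<Rightarrow> real \<Rightarrow> real \<Rightarrow> (real \<times> real) set" where
  "bwd_cone c s b = {(t, x). t \<le> s \<and> b - c * (s - t) \<le> x \<and> x \<le> b + c * (s - t)}"

definition diamond :: "real \<Rightarrow> real \<Rightarrow> real \<Rightarrow> real \<Rightarrow> real \<Rightarrow> (real \<times> real) set" where
  "diamond c r a s b = fwd_cone c r a \<inter> bwd_cone c s b"

definition mid_interval :: "real \<Rightarrow> real \<Rightarrow> real \<Rightarrow> real \<Rightarrow> real \<Rightarrow> real set" where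
  "mid_interval c r a s b = {x. ((r + s) / 2, x) \<in> diamond c r a s b}"

definition end_interval :: "real \<Rightarrow> real \<Rightarrow> real \<Rightarrow> real \<Rightarrow> real set" where
  "end_interval c r a s = {a - c * (s - r) .. a + c * (s - r)}"

text \<open>\<open>lam r a s b\<close> stands for \<open>\<lambda>\<^bsub>r,a\<^esub>\<^bsup>s,b\<^esup>\<close>, and \<open>mu r a s\<close> for \<open>\<lambda>\<^bsub>r,a\<^esub>\<^bsup>s\<^esup>\<close>.
  Both are total functions here; their values outside the parameter ranges below are
  unconstrained.\<close>

definition mid_parametrization ::
    "real \<Rightarrow> (real \<Rightarrow> real \<Rightarrow> real \<Rightarrow> real \<Rightarrow> real \<Rightarrow> real) \<Rightarrow> bool" where
  "mid_parametrization c lam \<longleftrightarrow>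
     (\<forall>r a s b. 0 \<le> r \<and> r < s \<and> diamond c r a s b \<noteq> {} \<longrightarrow>
        continuous_on {0..1} (lam r a s b) \<and>
        lam r a s b ` {0..1} = mid_interval c r a s b) \<and>
     continuous_on
       {(a, b, r, s, \<xi>). 0 \<le> r \<and> r < s \<and> \<bar>b - a\<bar> \<le> c * (s - r) \<and> \<xi> \<in> {0..1}}
       (\<lambda>(a, b, r, s, \<xi>). lam r a s b \<xi>)"

definition end_parametrization ::
    "real \<Rightarrow> (real \<Rightarrow> real \<Rightarrow> real \<Rightarrow> real \<Rightarrow> real) \<Rightarrow> bool" where
  "end_parametrization c mu \<longleftrightarrow>
     (\<forall>r a s. 0 \<le> r \<and> r < s \<longrightarrow>
        continuous_on {0..1} (mu r a s) \<and>
        mu r a s ` {0..1} = end_interval c r a s) \<and>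
     continuous_on {(a, r, s, \<xi>). 0 \<le> r \<and> r < s \<and> \<xi> \<in> {0..1}}
       (\<lambda>(a, r, s, \<xi>). mu r a s \<xi>)"

definition dyadic_pt :: "real \<Rightarrow> real \<Rightarrow> nat \<Rightarrow> nat \<Rightarrow> real" where
  "dyadic_pt r s n j = r + real j / 2 ^ n * (s - r)"

definition dyadics_level :: "real \<Rightarrow> real \<Rightarrow> nat \<Rightarrow> real set" where
  "dyadics_level r s n = {dyadic_pt r s n j | j. 0 < j \<and> j < 2 ^ n}"

definition dyadics :: "real \<Rightarrow> real \<Rightarrow> real set" where
  "dyadics r s = (\<Union>n\<in>{1..}. dyadics_level r s n)"

definition cube_top :: "real set \<Rightarrow> (real \<Rightarrow> real) topology" where
  "cube_top V = product_topology (\<lambda>_. top_of_set {0..1}) V"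

abbreviation Omega_hat :: "real \<Rightarrow> real \<Rightarrow> (real \<Rightarrow> real) topology" where
  "Omega_hat r s \<equiv> cube_top (dyadics r s \<union> {s})"

abbreviation Omega_check :: "real \<Rightarrow> real \<Rightarrow> (real \<Rightarrow> real) topology" where
  "Omega_check r s \<equiv> cube_top (dyadics r s \<union> {r})"

text \<open>Paths on \<open>[r,s]\<close> are represented by functions that are \<^const>\<open>undefined\<close> off \<open>[r,s]\<close>.\<close>

definition C_top :: "real \<Rightarrow> real \<Rightarrow> (real \<Rightarrow> real) topology" where
  "C_top r s = mtopology_of (cfunspace (top_of_set {r..s}) euclidean_metric)"

lemma topspace_C_top:
  "topspace (C_top r s) = {x \<in> extensional {r..s}. continuous_on {r..s} x}"
proof -
  have "bounded (x ` {r..s})" if "continuous_on {r..s} x" for x :: "real \<Rightarrow> real"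
    using that by (simp add: compact_continuous_image compact_imp_bounded)
  then show ?thesis
    by (auto simp: C_top_def)
qed

definition Lip_paths :: "real \<Rightarrow> real \<Rightarrow> real \<Rightarrow> (real \<Rightarrow> real) set" where
  "Lip_paths c r s =
     {x \<in> topspace (C_top r s). \<forall>u\<in>{r..s}. \<forall>v\<in>{r..s}. \<bar>x v - x u\<bar> \<le> c * \<bar>v - u\<bar>}"

definition Lip_top :: "real \<Rightarrow> real \<Rightarrow> real \<Rightarrow> (real \<Rightarrow> real) topology" where
  "Lip_top c r s = subtopology (C_top r s) (Lip_paths c r s)"

definition Lip_from_top :: "real \<Rightarrow> real \<Rightarrow> real \<Rightarrow> real \<Rightarrow> (real \<Rightarrow> real) topology" where
  "Lip_from_top c r a s = subtopology (C_top r s) {x \<in> Lip_paths c r s. x r = a}"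

definition Lip_to_top :: "real \<Rightarrow> real \<Rightarrow> real \<Rightarrow> real \<Rightarrow> (real \<Rightarrow> real) topology" where
  "Lip_to_top c r s b = subtopology (C_top r s) {x \<in> Lip_paths c r s. x s = b}"

text \<open>\<open>dyadic_val lam r a s b \<omega> m i\<close> is the value \<open>a\<^bsub>m,i\<^esub>\<close> prescribed at the point
  \<open>t\<^bsub>m,i\<^esub>\<close>, for \<open>i \<le> 2\<^sup>m\<close>. An odd index \<open>i = 2 * j - 1\<close> has \<open>i div 2 = j - 1\<close>.\<close>

fun dyadic_val ::
    "(real \<Rightarrow> real \<Rightarrow> real \<Rightarrow> real \<Rightarrow> real \<Rightarrow> real) \<Rightarrow> real \<Rightarrow> real \<Rightarrow> real \<Rightarrow> real \<Rightarrow>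
     (real \<Rightarrow> real) \<Rightarrow> nat \<Rightarrow> nat \<Rightarrow> real" where
  "dyadic_val lam r a s b \<omega> 0 i = (if i = 0 then a else b)"
| "dyadic_val lam r a s b \<omega> (Suc m) i =
     (if even i then dyadic_val lam r a s b \<omega> m (i div 2)
      else lam (dyadic_pt r s m (i div 2)) (dyadic_val lam r a s b \<omega> m (i div 2))
               (dyadic_pt r s m (i div 2 + 1)) (dyadic_val lam r a s b \<omega> m (i div 2 + 1))
               (\<omega> (dyadic_pt r s (Suc m) i)))"

definition phi ::
    "(real \<Rightarrow> real \<Rightarrow> real \<Rightarrow> real \<Rightarrow> real \<Rightarrow> real) \<Rightarrow> real \<Rightarrow> real \<Rightarrow> real \<Rightarrow> real \<Rightarrow>
     (real \<Rightarrow> real) \<Rightarrow> (real \<Rightarrow> real)" where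
  "phi lam r a s b \<omega> =
     (THE x. x \<in> topspace (C_top r s) \<and>
        (\<forall>m i. i \<le> 2 ^ m \<longrightarrow> x (dyadic_pt r s m i) = dyadic_val lam r a s b \<omega> m i))"

definition phi_from ::
    "(real \<Rightarrow> real \<Rightarrow> real \<Rightarrow> real \<Rightarrow> real \<Rightarrow> real) \<Rightarrow> (real \<Rightarrow> real \<Rightarrow> real \<Rightarrow> real \<Rightarrow> real) \<Rightarrow>
     real \<Rightarrow> real \<Rightarrow> real \<Rightarrow> (real \<Rightarrow> real) \<Rightarrow> (real \<Rightarrow> real)" where
  "phi_from lam mu r a s \<omega> = phi lam r a s (mu r a s (\<omega> s)) (restrict \<omega> (dyadics r s))"

text \<open>The starting value \<open>a'\<close> is \<open>\<lambda>\<^bsub>r,b\<^esub>\<^bsup>s\<^esup>\<close> at \<open>\<omega> r\<close>: the interval of admissible starting values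
  of a path ending at \<open>b\<close> is again \<open>[b - c (s - r), b + c (s - r)]\<close>.\<close>

definition phi_to ::
    "(real \<Rightarrow> real \<Rightarrow> real \<Rightarrow> real \<Rightarrow> real \<Rightarrow> real) \<Rightarrow> (real \<Rightarrow> real \<Rightarrow> real \<Rightarrow> real \<Rightarrow> real) \<Rightarrow>
     real \<Rightarrow> real \<Rightarrow> real \<Rightarrow> (real \<Rightarrow> real) \<Rightarrow> (real \<Rightarrow> real)" where
  "phi_to lam mu r s b \<omega> = phi lam r (mu r b s (\<omega> r)) s b (restrict \<omega> (dyadics r s))"

end

theory Submission
  imports Defs
begin

text \<open>
  Every path in \<open>Lip_paths c r s\<close> is \<open>c\<close>-Lipschitz with the same constant \<open>c\<close>, so up to an error
  of order \<open>c * (s - r) / 2 ^ m\<close> such a path is determined, uniformly on \<open>[r,s]\<close>, by its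
  finitely many values on the dyadic grid of level \<open>m\<close>. Hence a map into \<open>Lip_top c r s\<close> is
  continuous as soon as its evaluation at each single dyadic point is continuous
  (\<open>continuous_map_into_Lip_top\<close>).

  For the path \<open>phi\<close> these evaluations are the numbers \<open>dyadic_val\<close>. They arise by finitely many
  applications of the parametrization \<open>\<lambda>\<close> to earlier values and to one coordinate of \<open>\<omega>\<close>, and \<open>\<lambda>\<close> is
  jointly continuous, so each of them is continuous in the end values and in \<open>\<omega>\<close>
  (\<open>continuous_map_dyadic_val\<close>). Joint continuity of \<open>\<lambda>\<close> is available only on the parameter set
  where \<open>\<bar>b - a\<bar> \<le> c * (s - r)\<close>; that the recursion never leaves this set is the step bound
  \<open>dyadic_val_step\<close>, which also makes the prescribed values \<open>c\<close>-Lipschitz on the dyadic points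
  and so yields the existence of \<open>phi\<close>.

  Both maps of the theorem have the form \<open>p \<mapsto> phi lam r (A p) s (B p) (W p)\<close>, with the values at the
  two ends and the coordinates depending continuously on the parameter \<open>p\<close>: one end value is the
  real argument itself, the other one is read off from the remaining coordinate of the cube through
  the parametrization \<open>mu\<close>. They are therefore instances of the single statement
  \<open>continuous_map_phi\<close>, and the last two claims follow by fixing the real argument, which is an end
  value of the path.
\<close>

section \<open>The dyadic grid\<close>

lemma dyadic_pt_0 [simp]: "dyadic_pt r s m 0 = r"
  by (simp add: dyadic_pt_def)

lemma dyadic_pt_last [simp]: "dyadic_pt r s m (2 ^ m) = s"
  by (simp add: dyadic_pt_def)

lemma dyadic_pt_Suc: "dyadic_pt r s m (Suc i) - dyadic_pt r s m i = (s - r) / 2 ^ m"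
  by (simp add: dyadic_pt_def field_simps)

lemma dyadic_pt_refine: "dyadic_pt r s (m + k) (2 ^ k * i) = dyadic_pt r s m i"
  by (simp add: dyadic_pt_def power_add field_simps)

lemma dyadic_pt_mono: "r < s \<Longrightarrow> i \<le> j \<Longrightarrow> dyadic_pt r s m i \<le> dyadic_pt r s m j"
  by (simp add: dyadic_pt_def divide_right_mono mult_right_mono)

lemma dyadic_pt_in_interval:
  assumes "r < s" "i \<le> 2 ^ m"
  shows "dyadic_pt r s m i \<in> {r..s}"
  using dyadic_pt_mono[of r s 0 i m] dyadic_pt_mono[of r s i "2 ^ m" m] assms by simp

lemma odd_dyadic_pt_in_dyadics:
  assumes "i < 2 ^ Suc m" "odd i"
  shows "dyadic_pt r s (Suc m) i \<in> dyadics r s"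
  using assms unfolding dyadics_def dyadics_level_def
  by (intro UN_I[of "Suc m"]) (auto intro!: exI[of _ i] elim: oddE)

text \<open>The grid index is obtained by rounding the position of \<open>t\<close>, measured in mesh widths, down
  to an integer.\<close>

lemma dyadic_pt_near:
  assumes "r < s" "t \<in> {r..s}"
  obtains i where "i \<le> 2 ^ m" "\<bar>t - dyadic_pt r s m i\<bar> \<le> (s - r) / 2 ^ m"
proof -
  define q where "q = (t - r) / (s - r) * 2 ^ m"
  define i where "i = nat \<lfloor>q\<rfloor>"
  have "0 \<le> q" and "q \<le> 2 ^ m"
    using assms by (auto simp: q_def divide_simps)
  then have i: "real i \<le> q" "q < real i + 1"
    unfolding i_def by linarith+
  have "real i \<le> 2 ^ m"
    using i \<open>q \<le> 2 ^ m\<close> by linarith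
  then have "i \<le> 2 ^ m"
    by (metis of_nat_le_iff of_nat_numeral of_nat_power)
  moreover have "t - dyadic_pt r s m i = (q - real i) * ((s - r) / 2 ^ m)"
    using assms by (simp add: q_def dyadic_pt_def field_simps)
  moreover have "\<bar>(q - real i) * ((s - r) / 2 ^ m)\<bar> \<le> 1 * ((s - r) / 2 ^ m)"
    unfolding abs_mult using i assms by (intro mult_mono) auto
  ultimately show thesis
    using that by simp
qed

lemma dyadic_mesh_small:
  fixes C \<epsilon> :: real
  assumes "0 < \<epsilon>"
  obtains m where "C / 2 ^ m < \<epsilon>"
proof -
  have "(\<lambda>m. C * (1 / 2) ^ m) \<longlonglongrightarrow> C * 0"
    by (intro tendsto_mult_left LIMSEQ_power_zero) simp
  then have "\<forall>\<^sub>F m in sequentially. C * (1 / 2) ^ m < \<epsilon>"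
    using assms by (intro order_tendstoD) auto
  then show thesis
    using that by (auto simp: eventually_sequentially power_divide)
qed

section \<open>Lipschitz bounds for the prescribed values\<close>

lemma diamond_nonempty:
  assumes "r < s" "\<bar>b - a\<bar> \<le> c * (s - r)"
  shows "diamond c r a s b \<noteq> {}"
proof -
  have "(r, a) \<in> diamond c r a s b"
    using assms by (auto simp: diamond_def fwd_cone_def bwd_cone_def)
  then show ?thesis by blast
qed

text \<open>The midpoint of a diamond lies at time distance \<open>(s - r) / 2\<close> from both apexes, so membership in
  the two cones says exactly that neither half step is steeper than \<open>c\<close>.\<close>

lemma mid_parametrization_bounds:
  assumes "mid_parametrization c lam" "0 \<le> r" "r < s" "\<bar>b - a\<bar> \<le> c * (s - r)" "\<xi> \<in> {0..1}"
  shows "\<bar>lam r a s b \<xi> - a\<bar> \<le> c * ((s - r) / 2)" "\<bar>b - lam r a s b \<xi>\<bar> \<le> c * ((s - r) / 2)"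
proof -
  have "lam r a s b ` {0..1} = mid_interval c r a s b"
    using assms diamond_nonempty[OF assms(3,4)] unfolding mid_parametrization_def by blast
  then have "lam r a s b \<xi> \<in> mid_interval c r a s b"
    using assms(5) by blast
  moreover have "(r + s) / 2 - r = (s - r) / 2" "s - (r + s) / 2 = (s - r) / 2"
    by (simp_all add: field_simps)
  ultimately have "a - c * ((s - r) / 2) \<le> lam r a s b \<xi>" "lam r a s b \<xi> \<le> a + c * ((s - r) / 2)"
      "b - c * ((s - r) / 2) \<le> lam r a s b \<xi>" "lam r a s b \<xi> \<le> b + c * ((s - r) / 2)"
    by (simp_all add: mid_interval_def diamond_def fwd_cone_def bwd_cone_def
        del: times_divide_eq_right)
  then show "\<bar>lam r a s b \<xi> - a\<bar> \<le> c * ((s - r) / 2)"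
      "\<bar>b - lam r a s b \<xi>\<bar> \<le> c * ((s - r) / 2)"
    by linarith+
qed

text \<open>This is the invariant of the recursion: neighbouring values of level \<open>m\<close> span a nonempty
  diamond. A new value is chosen in the middle interval of that diamond, and therefore both halves
  inherit the slope bound.\<close>

lemma dyadic_val_step:
  assumes "mid_parametrization c lam" "0 \<le> r" "r < s" "\<bar>b - a\<bar> \<le> c * (s - r)"
    and \<omega>: "\<omega> \<in> dyadics r s \<rightarrow> {0..1}"
    and "i < 2 ^ m"
  shows "\<bar>dyadic_val lam r a s b \<omega> m (Suc i) - dyadic_val lam r a s b \<omega> m i\<bar> \<le> c * ((s - r) / 2 ^ m)"
  using \<open>i < 2 ^ m\<close>
proof (induction m arbitrary: i)
  case 0
  then show ?case using assms by simp
next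
  case (Suc m)
  define k where "k = i div 2"
  define u v where "u = dyadic_pt r s m k" and "v = dyadic_pt r s m (Suc k)"
  define x y where "x = dyadic_val lam r a s b \<omega> m k" and "y = dyadic_val lam r a s b \<omega> m (Suc k)"
  \<comment> \<open>\<open>x\<close> and \<open>y\<close> are the neighbours of level \<open>m\<close> that enclose the step, and \<open>z\<close> is the value inserted
    between them; the step from \<open>i\<close> goes from \<open>x\<close> to \<open>z\<close> or from \<open>z\<close> to \<open>y\<close>.\<close>
  define z where "z = dyadic_val lam r a s b \<omega> (Suc m) (Suc (2 * k))"
  have k: "k < 2 ^ m"
    using Suc.prems by (simp add: k_def)
  have vu: "v - u = (s - r) / 2 ^ m"
    unfolding u_def v_def by (rule dyadic_pt_Suc)
  have "0 \<le> u"
    using dyadic_pt_in_interval[of r s k m] k assms by (simp add: u_def)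
  have "u < v"
    using vu assms(3) by (smt (verit) divide_pos_pos zero_less_power)
  have "\<bar>y - x\<bar> \<le> c * (v - u)"
    using Suc.IH[OF k] vu by (simp add: x_def y_def)
  moreover have z: "z = lam u x v y (\<omega> (dyadic_pt r s (Suc m) (Suc (2 * k))))"
    by (simp add: z_def u_def v_def x_def y_def)
  moreover have "\<omega> (dyadic_pt r s (Suc m) (Suc (2 * k))) \<in> {0..1}"
    using k by (intro funcset_mem[OF \<omega>] odd_dyadic_pt_in_dyadics) auto
  ultimately have "\<bar>z - x\<bar> \<le> c * ((v - u) / 2)" "\<bar>y - z\<bar> \<le> c * ((v - u) / 2)"
    using mid_parametrization_bounds[OF assms(1) \<open>0 \<le> u\<close> \<open>u < v\<close>] by blast+
  then have *: "\<bar>z - x\<bar> \<le> c * ((s - r) / 2 ^ Suc m)" "\<bar>y - z\<bar> \<le> c * ((s - r) / 2 ^ Suc m)"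
    by (simp_all add: vu mult.commute)
  show ?case
  proof (cases "even i")
    case True
    then have "i = 2 * k" by (simp add: k_def)
    then show ?thesis
      using *(1) unfolding z_def x_def by simp
  next
    case False
    then have "i = Suc (2 * k)" by (simp add: k_def)
    then show ?thesis
      using *(2) unfolding z_def y_def by simp
  qed
qed

lemma dyadic_val_refine: "dyadic_val lam r a s b \<omega> (m + k) (2 ^ k * i) = dyadic_val lam r a s b \<omega> m i"
  by (induction k) (simp_all add: mult.assoc)

text \<open>On one level the bound is a telescoping sum of steps; two different levels \<open>m\<close> and \<open>n\<close> are
  compared on the common refinement \<open>m + n\<close>. For points that coincide, the bound says that the
  prescribed value does not depend on how a dyadic point is represented.\<close>

lemma dyadic_val_Lipschitz:
  assumes "mid_parametrization c lam" "0 \<le> r" "r < s" "\<bar>b - a\<bar> \<le> c * (s - r)"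
    and \<omega>: "\<omega> \<in> dyadics r s \<rightarrow> {0..1}"
    and "i \<le> 2 ^ m" "j \<le> 2 ^ n"
  shows "\<bar>dyadic_val lam r a s b \<omega> m i - dyadic_val lam r a s b \<omega> n j\<bar>
    \<le> c * \<bar>dyadic_pt r s m i - dyadic_pt r s n j\<bar>"
proof -
  let ?val = "dyadic_val lam r a s b \<omega>" and ?pt = "dyadic_pt r s"
  have level: "\<bar>?val l q - ?val l p\<bar> \<le> c * (?pt l q - ?pt l p)" if "p \<le> q" "q \<le> 2 ^ l" for l p q
    using that
  proof (induction q rule: dec_induct)
    case (step q)
    have "\<bar>?val l (Suc q) - ?val l q\<bar> \<le> c * (?pt l (Suc q) - ?pt l q)"
      unfolding dyadic_pt_Suc using step.prems by (intro dyadic_val_step assms) auto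
    moreover have "\<bar>?val l q - ?val l p\<bar> \<le> c * (?pt l q - ?pt l p)"
      using step by simp
    ultimately show ?case
      by (simp add: algebra_simps)
  qed simp
  have level': "\<bar>?val l p - ?val l q\<bar> \<le> c * \<bar>?pt l p - ?pt l q\<bar>" if "p \<le> 2 ^ l" "q \<le> 2 ^ l" for l p q
    using level[of p q l] level[of q p l] that dyadic_pt_mono[of r s p q l] dyadic_pt_mono[of r s q p l] assms(3)
    by (cases p q rule: le_cases) (simp_all add: abs_minus_commute)
  have "\<bar>?val (m + n) (2 ^ n * i) - ?val (m + n) (2 ^ m * j)\<bar>
    \<le> c * \<bar>?pt (m + n) (2 ^ n * i) - ?pt (m + n) (2 ^ m * j)\<bar>"
    using assms(6,7) by (intro level') (simp_all add: power_add mult.commute)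
  moreover have "?val (m + n) (2 ^ m * j) = ?val n j" "?pt (m + n) (2 ^ m * j) = ?pt n j"
    using dyadic_val_refine[of lam r a s b \<omega> n m j] dyadic_pt_refine[of r s n m j]
    by (simp_all add: add.commute)
  ultimately show ?thesis
    by (simp add: dyadic_val_refine dyadic_pt_refine)
qed

section \<open>The path through the prescribed values\<close>

lemma closure_dyadic_pts:
  assumes "r < s"
  shows "{r..s} \<subseteq> closure {dyadic_pt r s m i | m i. i \<le> 2 ^ m}" (is "_ \<subseteq> closure ?D")
proof
  fix t assume t: "t \<in> {r..s}"
  have "\<exists>d\<in>?D. dist d t < \<epsilon>" if eps: "0 < \<epsilon>" for \<epsilon>
  proof -
    obtain m where "(s - r) / 2 ^ m < \<epsilon>"
      using dyadic_mesh_small[OF eps] .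
    moreover obtain i where "i \<le> 2 ^ m" "\<bar>t - dyadic_pt r s m i\<bar> \<le> (s - r) / 2 ^ m"
      using dyadic_pt_near[OF assms t] .
    ultimately show ?thesis
      by (intro bexI[of _ "dyadic_pt r s m i"]) (auto simp: dist_real_def)
  qed
  then show "t \<in> closure ?D"
    by (simp add: closure_approachable)
qed

text \<open>The prescribed values form a Lipschitz function on the dense set of dyadic points. It extends to
  a Lipschitz function on \<open>[r,s]\<close>, and by density a continuous extension is unique, so the
  definite description in the definition of \<open>phi\<close> denotes this extension.\<close>

lemma
  assumes "mid_parametrization c lam" "0 \<le> r" "r < s" "\<bar>b - a\<bar> \<le> c * (s - r)"
    and \<omega>: "\<omega> \<in> dyadics r s \<rightarrow> {0..1}"
  shows phi_in_Lip_paths: "phi lam r a s b \<omega> \<in> Lip_paths c r s"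
    and phi_dyadic_pt: "i \<le> 2 ^ m \<Longrightarrow>
      phi lam r a s b \<omega> (dyadic_pt r s m i) = dyadic_val lam r a s b \<omega> m i"
proof -
  let ?val = "dyadic_val lam r a s b \<omega>" and ?pt = "dyadic_pt r s"
  define D where "D = {?pt m i | m i. i \<le> 2 ^ m}"
  define f where "f d = (SOME y. \<exists>m i. i \<le> 2 ^ m \<and> ?pt m i = d \<and> ?val m i = y)" for d
  \<comment> \<open>\<open>f d\<close> uses an arbitrary representation of \<open>d\<close>; the Lipschitz bound at distance \<open>0\<close> shows that all
    representations give the same value.\<close>
  have f: "f (?pt m i) = ?val m i" if "i \<le> 2 ^ m" for m i
  proof -
    have "\<exists>n j. j \<le> 2 ^ n \<and> ?pt n j = ?pt m i \<and> ?val n j = f (?pt m i)"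
      unfolding f_def by (rule someI[of _ "?val m i"]) (use that in blast)
    then obtain n j where "j \<le> 2 ^ n" "?pt n j = ?pt m i" "?val n j = f (?pt m i)"
      by blast
    then show ?thesis
      using dyadic_val_Lipschitz[OF assms that, of j n] by simp
  qed
  \<comment> \<open>A negative \<open>c\<close> is excluded because \<open>\<bar>b - a\<bar> \<le> c * (s - r)\<close>.\<close>
  have "0 \<le> c"
    using assms(3,4) by (smt (verit) mult_neg_pos)
  then have "c-lipschitz_on D f"
    using dyadic_val_Lipschitz[OF assms]
    by (auto simp: lipschitz_on_def D_def f dist_real_def)
  then obtain g where g: "c-lipschitz_on (closure D) g" "\<And>d. d \<in> D \<Longrightarrow> g d = f d"
    using lipschitz_extend_closure by blast
  have dense: "{r..s} \<subseteq> closure D"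
    unfolding D_def by (rule closure_dyadic_pts[OF assms(3)])
  define x where "x = restrict g {r..s}"
  have lip: "c-lipschitz_on {r..s} x"
    using lipschitz_on_subset[OF g(1) dense] by (simp add: x_def lipschitz_on_def)
  then have cont: "x \<in> topspace (C_top r s)"
    using lipschitz_on_continuous_on by (auto simp: topspace_C_top x_def)
  have val: "x (?pt m i) = ?val m i" if "i \<le> 2 ^ m" for m i
  proof -
    have "g (?pt m i) = f (?pt m i)"
      using that by (intro g(2)) (auto simp: D_def)
    then show ?thesis
      using f[OF that] dyadic_pt_in_interval[OF assms(3) that] by (simp add: x_def)
  qed
  have unique: "y = x" if y: "y \<in> topspace (C_top r s)"
      and y_val: "\<And>m i. i \<le> 2 ^ m \<Longrightarrow> y (?pt m i) = ?val m i" for y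
  proof -
    have "D \<subseteq> {r..s}"
      using dyadic_pt_in_interval[OF assms(3)] by (auto simp: D_def)
    then have "closure D = {r..s}"
      using dense by (simp add: closure_minimal subset_antisym)
    have "y t - x t = 0" if "t \<in> {r..s}" for t
    proof (rule continuous_constant_on_closure[of D "\<lambda>t. y t - x t"])
      show "continuous_on (closure D) (\<lambda>t. y t - x t)"
        using y cont by (auto simp: topspace_C_top \<open>closure D = {r..s}\<close> intro: continuous_on_diff)
      show "y d - x d = 0" if "d \<in> D" for d
        using that y_val val by (auto simp: D_def)
    qed (use that \<open>closure D = {r..s}\<close> in simp)
    then have "y t = x t" if "t \<in> {r..s}" for t
      using that by simp
    then show ?thesis
      using y cont by (auto simp: topspace_C_top intro: extensionalityI)
  qed
  have phi: "phi lam r a s b \<omega> = x"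
    unfolding phi_def
  proof (rule the_equality)
    show "x \<in> topspace (C_top r s) \<and> (\<forall>m i. i \<le> 2 ^ m \<longrightarrow> x (?pt m i) = ?val m i)"
      using cont val by blast
  qed (use unique in blast)
  show "phi lam r a s b \<omega> \<in> Lip_paths c r s"
    unfolding phi using cont lip by (auto simp: Lip_paths_def lipschitz_on_def dist_real_def)
  show "phi lam r a s b \<omega> (dyadic_pt r s m i) = dyadic_val lam r a s b \<omega> m i" if "i \<le> 2 ^ m"
    unfolding phi by (rule val[OF that])
qed

lemma phi_endpoints:
  assumes "mid_parametrization c lam" "0 \<le> r" "r < s" "\<bar>b - a\<bar> \<le> c * (s - r)"
    and "\<omega> \<in> dyadics r s \<rightarrow> {0..1}"
  shows "phi lam r a s b \<omega> r = a" "phi lam r a s b \<omega> s = b"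
proof -
  have "phi lam r a s b \<omega> (dyadic_pt r s 0 0) = dyadic_val lam r a s b \<omega> 0 0"
    by (rule phi_dyadic_pt[OF assms]) simp
  then show "phi lam r a s b \<omega> r = a"
    by simp
  have "phi lam r a s b \<omega> (dyadic_pt r s 0 (2 ^ 0)) = dyadic_val lam r a s b \<omega> 0 (2 ^ 0)"
    by (rule phi_dyadic_pt[OF assms]) simp
  then show "phi lam r a s b \<omega> s = b"
    unfolding dyadic_pt_last by simp
qed

section \<open>Continuous dependence\<close>

lemma continuous_map_Pair_euclidean:
  fixes f :: "'a \<Rightarrow> 'b::topological_space" and g :: "'a \<Rightarrow> 'c::topological_space"
  assumes "continuous_map X euclidean f" "continuous_map X euclidean g"
  shows "continuous_map X euclidean (\<lambda>x. (f x, g x))"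
proof -
  have "(euclidean :: ('b \<times> 'c) topology) = prod_topology euclidean euclidean"
    unfolding topology_eq openin_prod_topology_alt open_openin[symmetric]
    by (auto simp: open_prod_def mem_Times_iff Ball_def)
  then show ?thesis
    using continuous_map_pairedI[OF assms] by (simp only:)
qed

text \<open>The induction on the level composes the jointly continuous parametrization with the tuple of
  its arguments. The tuple has to be continuous as a map into the parameter set of \<open>\<lambda>\<close>, the only
  place where continuity is assumed; \<open>dyadic_val_step\<close> puts it there.\<close>

lemma continuous_map_dyadic_val:
  assumes lam: "mid_parametrization c lam" and "0 \<le> r" "r < s"
    and A: "continuous_map X euclideanreal A" and B: "continuous_map X euclideanreal B"
    and AB: "\<And>x. x \<in> topspace X \<Longrightarrow> \<bar>B x - A x\<bar> \<le> c * (s - r)"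
    and W: "\<And>v. v \<in> dyadics r s \<Longrightarrow> continuous_map X (top_of_set {0..1}) (\<lambda>x. W x v)"
    and "i \<le> 2 ^ m"
  shows "continuous_map X euclideanreal (\<lambda>x. dyadic_val lam r (A x) s (B x) (W x) m i)"
  using \<open>i \<le> 2 ^ m\<close>
proof (induction m arbitrary: i)
  case 0
  then show ?case using A B by simp
next
  case (Suc m)
  show ?case
  proof (cases "even i")
    case True
    then show ?thesis
      using Suc.IH[of "i div 2"] Suc.prems by simp
  next
    case False
    define k where "k = i div 2"
    have i: "i = Suc (2 * k)"
      using False by (simp add: k_def)
    have k: "k < 2 ^ m"
      using Suc.prems i by simp
    define u v w where "u = dyadic_pt r s m k" and "v = dyadic_pt r s m (Suc k)"
      and "w = dyadic_pt r s (Suc m) i"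
    let ?a = "\<lambda>x. dyadic_val lam r (A x) s (B x) (W x) m k"
    let ?b = "\<lambda>x. dyadic_val lam r (A x) s (B x) (W x) m (Suc k)"
    let ?S = "{(a, b, r, s, \<xi>). 0 \<le> r \<and> r < s \<and> \<bar>b - a\<bar> \<le> c * (s - r) \<and> \<xi> \<in> {0..1::real}}"
    have vu: "v - u = (s - r) / 2 ^ m"
      unfolding u_def v_def by (rule dyadic_pt_Suc)
    have "0 \<le> u"
      using dyadic_pt_in_interval[of r s k m] k assms by (simp add: u_def)
    have "u < v"
      using vu assms(3) by (smt (verit) divide_pos_pos zero_less_power)
    have "w \<in> dyadics r s"
      unfolding w_def using False i k by (intro odd_dyadic_pt_in_dyadics) auto
    note Ww = W[OF this]
    have W01: "W x \<in> dyadics r s \<rightarrow> {0..1}" if "x \<in> topspace X" for x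
      using W that by (auto simp: continuous_map_in_subtopology Pi_iff)
    have "(?a x, ?b x, u, v, W x w) \<in> ?S" if "x \<in> topspace X" for x
      using dyadic_val_step[OF lam \<open>0 \<le> r\<close> \<open>r < s\<close> AB[OF that] W01[OF that] k]
        \<open>0 \<le> u\<close> \<open>u < v\<close> funcset_mem[OF W01[OF that] \<open>w \<in> dyadics r s\<close>] vu by simp
    moreover have "continuous_map X euclideanreal (\<lambda>x. W x w)"
      using Ww continuous_map_in_subtopology by blast
    then have "continuous_map X euclidean (\<lambda>x. (?a x, ?b x, u, v, W x w))"
      using k by (intro continuous_map_Pair_euclidean Suc.IH) auto
    ultimately have "continuous_map X (top_of_set ?S) (\<lambda>x. (?a x, ?b x, u, v, W x w))"
      by (intro continuous_map_into_subtopology) auto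
    moreover have "continuous_map (top_of_set ?S) euclideanreal (\<lambda>(a, b, r, s, \<xi>). lam r a s b \<xi>)"
      using lam by (simp add: mid_parametrization_def)
    ultimately have "continuous_map X euclideanreal
        ((\<lambda>(a, b, r, s, \<xi>). lam r a s b \<xi>) \<circ> (\<lambda>x. (?a x, ?b x, u, v, W x w)))"
      by (rule continuous_map_compose)
    then show ?thesis
      by (simp add: o_def i u_def v_def w_def)
  qed
qed

text \<open>Some grid point is at most one mesh width away from \<open>t\<close>, and on the way to it each of the two
  paths moves by at most \<open>c\<close> times that width, which gives the factor \<open>2\<close>.\<close>

lemma Lip_paths_close:
  assumes "r < s" "0 \<le> c" "x \<in> Lip_paths c r s" "y \<in> Lip_paths c r s"
    and close: "\<And>i. i \<le> 2 ^ m \<Longrightarrow> \<bar>x (dyadic_pt r s m i) - y (dyadic_pt r s m i)\<bar> \<le> \<delta>"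
    and t: "t \<in> {r..s}"
  shows "\<bar>x t - y t\<bar> \<le> \<delta> + 2 * (c * (s - r) / 2 ^ m)"
proof -
  obtain i where i: "i \<le> 2 ^ m" "\<bar>t - dyadic_pt r s m i\<bar> \<le> (s - r) / 2 ^ m"
    using dyadic_pt_near[OF assms(1) t] .
  have "c * \<bar>t - dyadic_pt r s m i\<bar> \<le> c * (s - r) / 2 ^ m"
    using mult_left_mono[OF i(2) assms(2)] by simp
  moreover have "\<bar>x t - x (dyadic_pt r s m i)\<bar> \<le> c * \<bar>t - dyadic_pt r s m i\<bar>"
      "\<bar>y t - y (dyadic_pt r s m i)\<bar> \<le> c * \<bar>t - dyadic_pt r s m i\<bar>"
    using assms(3,4) t dyadic_pt_in_interval[OF assms(1) i(1)] by (simp_all add: Lip_paths_def)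
  ultimately show ?thesis
    using close[OF i(1)] by linarith
qed

text \<open>Equicontinuity turns pointwise into uniform control: for a prescribed \<open>\<epsilon>\<close>, closeness on one
  sufficiently fine finite grid forces closeness everywhere, and finitely many open conditions still
  define an open neighbourhood.\<close>

lemma continuous_map_into_Lip_top:
  assumes "r < s" "0 \<le> c"
    and F: "\<And>p. p \<in> topspace X \<Longrightarrow> F p \<in> Lip_paths c r s"
    and grid: "\<And>m i. i \<le> 2 ^ m \<Longrightarrow> continuous_map X euclideanreal (\<lambda>p. F p (dyadic_pt r s m i))"
  shows "continuous_map X (Lip_top c r s) F"
proof -
  let ?M = "cfunspace (top_of_set {r..s}) (euclidean_metric :: real metric)"
  have space: "F p \<in> mspace ?M" if "p \<in> topspace X" for p
    using F[OF that] by (simp add: Lip_paths_def C_top_def)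
  have "continuous_map X (C_top r s) F"
    unfolding C_top_def mtopology_of_def
      Metric_space.continuous_map_to_metric[OF Metric_space_mspace_mdist]
  proof (intro ballI allI impI)
    fix p :: 'a and \<epsilon> :: real
    assume p: "p \<in> topspace X" and "0 < \<epsilon>"
    \<comment> \<open>The budget is \<open>\<epsilon> / 4\<close> for the grid values and twice \<open>\<epsilon> / 4\<close> for the two paths between grid
      points, which leaves the strict inequality.\<close>
    obtain m where m: "c * (s - r) / 2 ^ m < \<epsilon> / 4"
      using dyadic_mesh_small[of "\<epsilon> / 4" "c * (s - r)"] \<open>0 < \<epsilon>\<close> by auto
    define N where "N i = {q \<in> topspace X.
      F q (dyadic_pt r s m i) \<in> ball (F p (dyadic_pt r s m i)) (\<epsilon> / 4)}" for i
    have "openin X (N i)" if "i \<le> 2 ^ m" for i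
      unfolding N_def by (rule openin_continuous_map_preimage[OF grid[OF that]]) simp
    then have "openin X (\<Inter>i\<in>{..2 ^ m}. N i)"
      by (intro openin_INT2) auto
    moreover have "p \<in> (\<Inter>i\<in>{..2 ^ m}. N i)"
      using p \<open>0 < \<epsilon>\<close> by (simp add: N_def)
    moreover have "F q \<in> Metric_space.mball (mspace ?M) (mdist ?M) (F p) \<epsilon>"
      if q: "q \<in> (\<Inter>i\<in>{..2 ^ m}. N i)" for q
    proof -
      have "q \<in> topspace X"
        using q by (auto simp: N_def)
      have "dist (F p t) (F q t) \<le> \<epsilon> / 4 + 2 * (c * (s - r) / 2 ^ m)" if "t \<in> {r..s}" for t
        unfolding dist_real_def
        by (rule Lip_paths_close[OF assms(1,2) F F])
          (use p q \<open>q \<in> topspace X\<close> that in \<open>auto simp: N_def dist_real_def intro: less_imp_le\<close>)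
      then have "mdist ?M (F p) (F q) \<le> \<epsilon> / 4 + 2 * (c * (s - r) / 2 ^ m)"
        using assms(1,2) \<open>0 < \<epsilon>\<close> by (intro mdist_cfunspace_le) auto
      also have "\<dots> < \<epsilon>"
        using m \<open>0 < \<epsilon>\<close> by linarith
      finally show ?thesis
        using space[OF p] space[OF \<open>q \<in> topspace X\<close>]
        unfolding Metric_space.in_mball[OF Metric_space_mspace_mdist] by blast
    qed
    ultimately show "\<exists>U. openin X U \<and> p \<in> U \<and>
        (\<forall>q\<in>U. F q \<in> Metric_space.mball (mspace ?M) (mdist ?M) (F p) \<epsilon>)"
      by blast
  qed
  then show ?thesis
    unfolding Lip_top_def using F by (intro continuous_map_into_subtopology) auto
qed

text \<open>The parameter space \<open>X\<close> is left arbitrary, so that the same statement serves both for the cube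
  alone and for its product with the real line, and for a free end on either side.\<close>

lemma continuous_map_phi:
  assumes lam: "mid_parametrization c lam" and "0 \<le> c" "0 \<le> r" "r < s"
    and A: "continuous_map X euclideanreal A" and B: "continuous_map X euclideanreal B"
    and AB: "\<And>x. x \<in> topspace X \<Longrightarrow> \<bar>B x - A x\<bar> \<le> c * (s - r)"
    and W: "\<And>v. v \<in> dyadics r s \<Longrightarrow> continuous_map X (top_of_set {0..1}) (\<lambda>x. W x v)"
  shows "continuous_map X (Lip_top c r s) (\<lambda>x. phi lam r (A x) s (B x) (W x))"
proof (rule continuous_map_into_Lip_top)
  have W01: "W x \<in> dyadics r s \<rightarrow> {0..1}" if "x \<in> topspace X" for x
    using W that by (auto simp: continuous_map_in_subtopology Pi_iff)
  show "phi lam r (A x) s (B x) (W x) \<in> Lip_paths c r s" if "x \<in> topspace X" for x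
    by (intro phi_in_Lip_paths assms AB W01 that)
  show "continuous_map X euclideanreal (\<lambda>x. phi lam r (A x) s (B x) (W x) (dyadic_pt r s m i))"
    if "i \<le> 2 ^ m" for m i
  proof (rule continuous_map_eq)
    show "continuous_map X euclideanreal (\<lambda>x. dyadic_val lam r (A x) s (B x) (W x) m i)"
      by (rule continuous_map_dyadic_val[OF lam assms(3,4) A B AB W that])
    show "dyadic_val lam r (A x) s (B x) (W x) m i = phi lam r (A x) s (B x) (W x) (dyadic_pt r s m i)"
      if "x \<in> topspace X" for x
      using phi_dyadic_pt[OF lam assms(3,4) AB[OF that] W01[OF that] \<open>i \<le> 2 ^ m\<close>] by simp
  qed
qed (use assms in auto)

lemma end_parametrization_bounds:
  assumes "end_parametrization c mu" "0 \<le> r" "r < s" "\<xi> \<in> {0..1}"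
  shows "\<bar>mu r a s \<xi> - a\<bar> \<le> c * (s - r)"
proof -
  have "mu r a s \<xi> \<in> end_interval c r a s"
    using assms unfolding end_parametrization_def by blast
  then show ?thesis
    by (auto simp: end_interval_def abs_le_iff)
qed

lemma continuous_map_end_parametrization:
  assumes mu: "end_parametrization c mu" and "0 \<le> r" "r < s"
    and A: "continuous_map X euclideanreal A"
    and Z: "continuous_map X (top_of_set {0..1}) Z"
  shows "continuous_map X euclideanreal (\<lambda>x. mu r (A x) s (Z x))"
proof -
  let ?S = "{(a, r, s, \<xi>). 0 \<le> r \<and> r < s \<and> \<xi> \<in> {0..1::real}} :: (real \<times> real \<times> real \<times> real) set"
  have "continuous_map X euclidean (\<lambda>x. (A x, r, s, Z x))"
    using Z by (intro continuous_map_Pair_euclidean A) (auto simp: continuous_map_in_subtopology)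
  then have "continuous_map X (top_of_set ?S) (\<lambda>x. (A x, r, s, Z x))"
    using Z assms(2,3) by (intro continuous_map_into_subtopology) (auto simp: continuous_map_in_subtopology)
  moreover have "continuous_map (top_of_set ?S) euclideanreal (\<lambda>(a, r, s, \<xi>). mu r a s \<xi>)"
    using mu by (simp add: end_parametrization_def)
  ultimately have "continuous_map X euclideanreal
      ((\<lambda>(a, r, s, \<xi>). mu r a s \<xi>) \<circ> (\<lambda>x. (A x, r, s, Z x)))"
    by (rule continuous_map_compose)
  then show ?thesis
    by (simp add: o_def)
qed

lemma continuous_map_cube_coordinate:
  assumes "v \<in> V"
  shows "continuous_map (cube_top V) (top_of_set {0..1}) (\<lambda>\<omega>. \<omega> v)"
  unfolding cube_top_def by (rule continuous_map_product_projection[OF assms])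

lemma topspace_cube_top: "topspace (cube_top V) = (\<Pi>\<^sub>E v\<in>V. {0..1})"
  by (simp add: cube_top_def)

lemma continuous_map_phi_from:
  assumes lam: "mid_parametrization c lam" and mu: "end_parametrization c mu"
    and "0 \<le> c" "0 \<le> r" "r < s"
    and A: "continuous_map X euclideanreal A" and W: "continuous_map X (Omega_hat r s) W"
  shows "continuous_map X (Lip_top c r s) (\<lambda>x. phi_from lam mu r (A x) s (W x))"
proof -
  have coord: "continuous_map X (top_of_set {0..1}) (\<lambda>x. W x v)" if "v \<in> dyadics r s \<union> {s}" for v
    using continuous_map_compose[OF W continuous_map_cube_coordinate[OF that]] by (simp add: o_def)
  have "W x s \<in> {0..1}" if "x \<in> topspace X" for x
    using coord[of s] that by (auto simp: continuous_map_in_subtopology)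
  then show ?thesis
    unfolding phi_from_def
    using end_parametrization_bounds[OF mu assms(4,5)] coord
    by (intro continuous_map_phi continuous_map_end_parametrization[OF mu] assms) auto
qed

lemma continuous_map_phi_to:
  assumes lam: "mid_parametrization c lam" and mu: "end_parametrization c mu"
    and "0 \<le> c" "0 \<le> r" "r < s"
    and B: "continuous_map X euclideanreal B" and W: "continuous_map X (Omega_check r s) W"
  shows "continuous_map X (Lip_top c r s) (\<lambda>x. phi_to lam mu r s (B x) (W x))"
proof -
  have coord: "continuous_map X (top_of_set {0..1}) (\<lambda>x. W x v)" if "v \<in> dyadics r s \<union> {r}" for v
    using continuous_map_compose[OF W continuous_map_cube_coordinate[OF that]] by (simp add: o_def)
  have "W x r \<in> {0..1}" if "x \<in> topspace X" for x
    using coord[of r] that by (auto simp: continuous_map_in_subtopology)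
  then show ?thesis
    unfolding phi_to_def
    using end_parametrization_bounds[OF mu assms(4,5)] coord
    by (intro continuous_map_phi continuous_map_end_parametrization[OF mu] assms)
      (auto simp: abs_minus_commute)
qed

lemma phi_from_start:
  assumes "mid_parametrization c lam" "end_parametrization c mu" "0 \<le> r" "r < s"
    and "\<omega> \<in> topspace (Omega_hat r s)"
  shows "phi_from lam mu r a s \<omega> r = a"
  unfolding phi_from_def using assms(5)
  by (intro phi_endpoints(1)[OF assms(1,3,4)] end_parametrization_bounds[OF assms(2-4)])
    (auto simp: topspace_cube_top PiE_iff)

lemma phi_to_end:
  assumes "mid_parametrization c lam" "end_parametrization c mu" "0 \<le> r" "r < s"
    and "\<omega> \<in> topspace (Omega_check r s)"
  shows "phi_to lam mu r s b \<omega> s = b"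
  unfolding phi_to_def using assms(5)
  by (intro phi_endpoints(2)[OF assms(1,3,4)],
      subst abs_minus_commute, intro end_parametrization_bounds[OF assms(2-4)])
    (auto simp: topspace_cube_top PiE_iff)

theorem theorem2p7:
  fixes c r s :: real
    and lam :: "real \<Rightarrow> real \<Rightarrow> real \<Rightarrow> real \<Rightarrow> real \<Rightarrow> real"
    and mu :: "real \<Rightarrow> real \<Rightarrow> real \<Rightarrow> real \<Rightarrow> real"
  assumes "c > 0"
    and "mid_parametrization c lam"
    and "end_parametrization c mu"
    and "0 \<le> r" and "r < s"
  shows "continuous_map (prod_topology euclideanreal (Omega_hat r s)) (Lip_top c r s)
           (\<lambda>(a, \<omega>). phi_from lam mu r a s \<omega>) \<and>
         continuous_map (prod_topology euclideanreal (Omega_check r s)) (Lip_top c r s)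
           (\<lambda>(b, \<omega>). phi_to lam mu r s b \<omega>) \<and>
         (\<forall>a. continuous_map (Omega_hat r s) (Lip_from_top c r a s)
           (phi_from lam mu r a s)) \<and>
         (\<forall>b. continuous_map (Omega_check r s) (Lip_to_top c r s b)
           (phi_to lam mu r s b))"
proof (intro conjI allI)
  have "0 \<le> c" using assms(1) by simp
  note phi_from_cont = continuous_map_phi_from[OF assms(2,3) \<open>0 \<le> c\<close> assms(4,5)]
  note phi_to_cont = continuous_map_phi_to[OF assms(2,3) \<open>0 \<le> c\<close> assms(4,5)]
  show "continuous_map (prod_topology euclideanreal (Omega_hat r s)) (Lip_top c r s)
      (\<lambda>(a, \<omega>). phi_from lam mu r a s \<omega>)"
    unfolding case_prod_beta by (rule phi_from_cont[OF continuous_map_fst continuous_map_snd])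
  show "continuous_map (prod_topology euclideanreal (Omega_check r s)) (Lip_top c r s)
      (\<lambda>(b, \<omega>). phi_to lam mu r s b \<omega>)"
    unfolding case_prod_beta by (rule phi_to_cont[OF continuous_map_fst continuous_map_snd])
  show "continuous_map (Omega_hat r s) (Lip_from_top c r a s) (phi_from lam mu r a s)" for a
    using phi_from_cont[of "Omega_hat r s" "\<lambda>_. a" "\<lambda>\<omega>. \<omega>"] phi_from_start[OF assms(2-5)]
    by (auto simp: Lip_top_def Lip_from_top_def continuous_map_in_subtopology)
  show "continuous_map (Omega_check r s) (Lip_to_top c r s b) (phi_to lam mu r s b)" for b
    using phi_to_cont[of "Omega_check r s" "\<lambda>_. b" "\<lambda>\<omega>. \<omega>"] phi_to_end[OF assms(2-5)]
    by (auto simp: Lip_top_def Lip_to_top_def continuous_map_in_subtopology)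
qed

end
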